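(* Let $m>0$ be a fixed integer and let $S$ be a monoid such that (i) $S$ satisfies $x^m\,y_1^2y_2^2\cdots y_n^2\,x\approx x^{m+1}\,y_1^2y_2^2\cdots y_n^2\,x$ for each $n>1$; (ii) for each $0<d<m+1$ and every identity $x^{m+1-d}tx^d\approx\mathbf v$ satisfied by $S$, the variable $x$ occurs exactly $m+1$ times in $\mathbf v$; (iii) for all $p,c>1$, every word $\mathbf w$ such that $S$ satisfies $x^py^c\approx\mathbf w$ is of the form $x^iy^j$ for some $i,j>1$. Then $S$ is non-finitely based.
   Context: All letters denote distinct variables of a countably infinite alphabet; words are elements of the free semigroup on it. A monoid $S$ satisfies an identity $\mathbf u\approx\mathbf v$ if both sides are equal under every evaluation of the variables in $S$. $S$ is finitely based if all its identities are derivable from a finite subset of them; otherwise non-finitely based. *)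

theory Defs
  imports Main
begin

text \<open>Variables are natural numbers (a countably infinite alphabet); words are
  lists of variables (identities use nonempty words, i.e. elements of the free semigroup).\<close>

type_synonym word = "nat list"

definition eval_word :: "(nat \<Rightarrow> 'a::monoid_mult) \<Rightarrow> word \<Rightarrow> 'a" where
  "eval_word \<phi> w = prod_list (map \<phi> w)"

definition satisfies :: "'a::monoid_mult itself \<Rightarrow> word \<Rightarrow> word \<Rightarrow> bool" where
  "satisfies S u v \<longleftrightarrow> (\<forall>\<phi> :: nat \<Rightarrow> 'a. eval_word \<phi> u = eval_word \<phi> v)"

definition identities :: "'a::monoid_mult itself \<Rightarrow> (word \<times> word) set" where
  "identities S = {(u, v). u \<noteq> [] \<and> v \<noteq> [] \<and> satisfies S u v}"

definition subst_word :: "(nat \<Rightarrow> word) \<Rightarrow> word \<Rightarrow> word" where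
  "subst_word \<sigma> w = concat (map \<sigma> w)"

text \<open>One step of (monoid) equational deduction: replace a substitution instance
  of one side of an identity of \<Sigma> by the corresponding instance of the other side.
  Substitutions may map variables to the empty word (monoid setting).\<close>
definition deriv_step :: "(word \<times> word) set \<Rightarrow> word \<Rightarrow> word \<Rightarrow> bool" where
  "deriv_step \<Sigma> u v \<longleftrightarrow> (\<exists>a b s t \<sigma>. ((s, t) \<in> \<Sigma> \<or> (t, s) \<in> \<Sigma>) \<and>
       u = a @ subst_word \<sigma> s @ b \<and> v = a @ subst_word \<sigma> t @ b)"

definition derivable :: "(word \<times> word) set \<Rightarrow> word \<Rightarrow> word \<Rightarrow> bool" where
  "derivable \<Sigma> u v \<longleftrightarrow> (deriv_step \<Sigma>)\<^sup>*\<^sup>* u v"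

definition finitely_based :: "'a::monoid_mult itself \<Rightarrow> bool" where
  "finitely_based S \<longleftrightarrow> (\<exists>\<Sigma>. finite \<Sigma> \<and> \<Sigma> \<subseteq> identities S \<and>
      (\<forall>(u, v) \<in> identities S. derivable \<Sigma> u v))"

end

theory Submission
  imports Defs
begin

text \<open>Suppose a finite basis \<open>\<Sigma>\<close> exists and take \<open>n\<close> larger than the number of variables of every
  identity in \<open>\<Sigma>\<close>. No deduction step starting from a word \<open>W\<close> that \<open>S\<close> identifies with
  \<open>x\<^sup>m y\<^sub>1\<^sup>2 \<dots> y\<^sub>n\<^sup>2 x\<close> and that contains \<open>x\<close> exactly \<open>m + 1\<close> times can change the number of
  occurrences of \<open>x\<close>. Indeed, let \<open>W = \<sigma>(s)\<close> and replace \<open>s\<close> by \<open>t\<close>. By (ii) a variable occurring at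
  most \<open>m\<close> times in \<open>s\<close> occurs equally often in \<open>t\<close>, so the only problematic case is that \<open>x\<close> comes from
  a single variable \<open>z\<close> occurring \<open>m + 1\<close> times in \<open>s\<close>. Since \<open>s\<close> has few variables, some \<open>\<sigma>(c)\<close>
  contains two different \<open>y\<^sub>i, y\<^sub>j\<close>; by (iii) the \<open>y\<close>'s appear in order in \<open>W\<close>, so \<open>c\<close> is
  linear in \<open>s\<close>, and again by (iii) \<open>c\<close> lies between two occurrences of \<open>z\<close>. Erasing all variables
  but \<open>z\<close> and \<open>c\<close> then gives an identity to which (ii) applies.\<close>

section \<open>Words and substitutions\<close>

lemma eval_word_append [simp]: "eval_word \<phi> (u @ v) = eval_word \<phi> u * eval_word \<phi> v"
  by (simp add: eval_word_def)

lemma eval_word_subst: "eval_word \<phi> (subst_word \<sigma> w) = eval_word (\<lambda>x. eval_word \<phi> (\<sigma> x)) w"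
  by (induction w) (auto simp: subst_word_def eval_word_def)

lemma satisfies_sym: "satisfies S u v \<Longrightarrow> satisfies S v u"
  by (simp add: satisfies_def)

lemma satisfies_trans: "satisfies S u v \<Longrightarrow> satisfies S v w \<Longrightarrow> satisfies S u w"
  by (simp add: satisfies_def)

lemma satisfies_subst: "satisfies S u v \<Longrightarrow> satisfies S (subst_word \<sigma> u) (subst_word \<sigma> v)"
  by (simp add: satisfies_def eval_word_subst)

lemma satisfies_context: "satisfies S u v \<Longrightarrow> satisfies S (a @ u @ b) (a @ v @ b)"
  by (simp add: satisfies_def)

lemma subst_word_append [simp]: "subst_word \<sigma> (u @ v) = subst_word \<sigma> u @ subst_word \<sigma> v"
  by (simp add: subst_word_def)

lemma subst_word_Nil [simp]: "subst_word \<sigma> [] = []"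
  by (simp add: subst_word_def)

lemma subst_word_Cons [simp]: "subst_word \<sigma> (x # v) = \<sigma> x @ subst_word \<sigma> v"
  by (simp add: subst_word_def)

lemma set_subst_word [simp]: "set (subst_word \<sigma> w) = (\<Union>z\<in>set w. set (\<sigma> z))"
  by (simp add: subst_word_def)

lemma subst_word_cong: "(\<And>z. z \<in> set w \<Longrightarrow> \<sigma> z = \<tau> z) \<Longrightarrow> subst_word \<sigma> w = subst_word \<tau> w"
  by (induction w) auto

lemma count_subst_word:
  assumes "finite A" "set w \<subseteq> A"
  shows "count_list (subst_word \<sigma> w) x = (\<Sum>z\<in>A. count_list w z * count_list (\<sigma> z) x)"
  using assms(2)
proof (induction w)
  case (Cons y w)
  have "(\<Sum>z\<in>A. count_list (y # w) z * count_list (\<sigma> z) x)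
      = (\<Sum>z\<in>A. (if y = z then count_list (\<sigma> z) x else 0) + count_list w z * count_list (\<sigma> z) x)"
    by (rule sum.cong) auto
  also have "\<dots> = count_list (\<sigma> y) x + (\<Sum>z\<in>A. count_list w z * count_list (\<sigma> z) x)"
    using Cons.prems assms(1) by (simp add: sum.distrib)
  finally show ?case
    using Cons by simp
qed simp

lemma length_image_le_subst_word: "x \<in> set w \<Longrightarrow> length (\<sigma> x) \<le> length (subst_word \<sigma> w)"
  by (induction w) auto

lemma subst_word_eq_replicate:
  assumes "\<And>z. z \<in> set w \<Longrightarrow> set (\<sigma> z) \<subseteq> {a}"
  shows "\<exists>k. subst_word \<sigma> w = replicate k a"
proof -
  have "set (subst_word \<sigma> w) \<subseteq> {a}"
    using assms by auto
  then show ?thesis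
    by (metis empty_iff insert_iff replicate_eqI subsetD)
qed

lemma count_list_replicate: "count_list (replicate k a) b = (if a = b then k else 0)"
  by (induction k) auto

lemma subst_word_erase_others:
  "subst_word (\<lambda>y. if y = z then [a] else []) w = replicate (count_list w z) a"
  by (induction w) auto

text \<open>The word y_1^2 ... y_n^2, with y_k encoded as the variable \<open>k\<close>; this leaves
  0 free to encode x.\<close>

definition squares :: "nat \<Rightarrow> word" where
  "squares n = concat (map (\<lambda>k. [k, k]) [1..<n+1])"

lemma set_squares [simp]: "set (squares n) = {1..n}"
  by (auto simp: squares_def)

lemma subst_word_squares:
  "subst_word \<sigma> (squares n) = concat (map (\<lambda>k. \<sigma> k @ \<sigma> k) [1..<n+1])"
  unfolding squares_def by (induction n) auto

lemma upt_split: "a \<le> i \<Longrightarrow> i < (b::nat) \<Longrightarrow> [a..<b] = [a..<i] @ i # [Suc i..<b]"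
  by (metis le_add_diff_inverse less_imp_le_nat upt_add_eq_append upt_conv_Cons)

lemma subst_squares_single:
  assumes "i \<in> {1..n}" "\<And>k. k \<in> {1..n} \<Longrightarrow> k \<noteq> i \<Longrightarrow> \<sigma> k = []"
  shows "subst_word \<sigma> (squares n) = \<sigma> i @ \<sigma> i"
proof -
  have "[1..<n+1] = [1..<i] @ i # [Suc i..<n+1]"
    using assms(1) by (intro upt_split) auto
  moreover have "concat (map (\<lambda>k. \<sigma> k @ \<sigma> k) [1..<i]) = []"
    "concat (map (\<lambda>k. \<sigma> k @ \<sigma> k) [Suc i..<n+1]) = []"
    using assms by auto
  ultimately show ?thesis
    by (simp only: subst_word_squares map_append list.map concat_append concat.simps) simp
qed

lemma subst_squares_pair:
  assumes "1 \<le> i" "i < j" "j \<le> n" "\<And>k. k \<in> {1..n} \<Longrightarrow> k \<noteq> i \<Longrightarrow> k \<noteq> j \<Longrightarrow> \<sigma> k = []"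
  shows "subst_word \<sigma> (squares n) = \<sigma> i @ \<sigma> i @ \<sigma> j @ \<sigma> j"
proof -
  have "[1..<n+1] = [1..<i] @ i # [Suc i..<n+1]" "[Suc i..<n+1] = [Suc i..<j] @ j # [Suc j..<n+1]"
    using assms(1-3) by (auto intro!: upt_split simp del: upt_Suc)
  then have "[1..<n+1] = [1..<i] @ i # [Suc i..<j] @ j # [Suc j..<n+1]"
    by simp
  moreover have "concat (map (\<lambda>k. \<sigma> k @ \<sigma> k) [1..<i]) = []"
    "concat (map (\<lambda>k. \<sigma> k @ \<sigma> k) [Suc i..<j]) = []"
    "concat (map (\<lambda>k. \<sigma> k @ \<sigma> k) [Suc j..<n+1]) = []"
    using assms by auto
  ultimately show ?thesis
    by (simp only: subst_word_squares map_append list.map concat_append concat.simps) simp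
qed

section \<open>Consequences of conditions (ii) and (iii)\<close>

text \<open>\<open>linear_gap\<close> is condition (ii) with 0 for x and 1 for t;
  \<open>two_powers\<close> is (iii) with 0 for x and 1 for y.\<close>

locale word_conditions =
  fixes S :: "'a::monoid_mult itself" and m :: nat
  assumes m_pos: "m > 0"
    and linear_gap: "\<And>d v. 0 < d \<Longrightarrow> d < m + 1 \<Longrightarrow> v \<noteq> [] \<Longrightarrow>
      satisfies S (replicate (m + 1 - d) 0 @ [1] @ replicate d 0) v \<Longrightarrow>
      count_list v 0 = m + 1"
    and two_powers: "\<And>p c w. p > 1 \<Longrightarrow> c > 1 \<Longrightarrow> w \<noteq> [] \<Longrightarrow>
      satisfies S (replicate p 0 @ replicate c 1) w \<Longrightarrow>
      (\<exists>i j. i > 1 \<and> j > 1 \<and> w = replicate i 0 @ replicate j 1)"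
begin

text \<open>Erasing all variables but \<open>z\<close> leaves an identity between powers of 0.
  Padding the left side to x^m and appending t x gives x^m t x, to which (ii) with d = 1
  applies.\<close>

lemma count_eq_if_le:
  assumes "satisfies S u v" "count_list u z \<le> m"
  shows "count_list v z = count_list u z"
proof -
  let ?a = "count_list u z" and ?b = "count_list v z"
  have "satisfies S (replicate ?a 0) (replicate ?b 0)"
    using satisfies_subst[OF assms(1), of "\<lambda>y. if y = z then [0] else []"]
    by (simp add: subst_word_erase_others)
  then have "satisfies S (replicate (m - ?a) 0 @ replicate ?a 0 @ [1,0])
      (replicate (m - ?a) 0 @ replicate ?b 0 @ [1,0])"
    by (rule satisfies_context)
  moreover have "replicate (m - ?a) 0 @ replicate ?a 0 @ [1,0]
      = replicate (m + 1 - 1) 0 @ [1] @ replicate 1 (0::nat)"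
    using assms(2) by (simp flip: replicate_add append_assoc)
  ultimately have "satisfies S (replicate (m + 1 - 1) 0 @ [1] @ replicate 1 0)
      (replicate (m - ?a) 0 @ replicate ?b 0 @ [1,0])"
    by (simp only:)
  then have "count_list (replicate (m - ?a) 0 @ replicate ?b 0 @ [1,0::nat]) 0 = m + 1"
    by (rule linear_gap[rotated 3]) (use m_pos in auto)
  then show ?thesis
    using assms(2) by (simp add: count_list_replicate)
qed

text \<open>The case of zero occurrences, used in both directions.\<close>

lemma satisfies_set_eq: "satisfies S u v \<Longrightarrow> set u = set v"
  using count_eq_if_le[of u v] count_eq_if_le[of v u] satisfies_sym[of S u v]
  by (metis count_list_0_iff le0 subsetI subset_antisym)

text \<open>With \<open>z\<close> sent to x, \<open>c\<close> to t and the rest erased, the left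
  side becomes x^(m+1-d) t x^d, where d counts \<open>z\<close> in \<open>u2\<close>. Since
  \<open>z\<close> occurs on both sides of \<open>c\<close>, 0 < d < m + 1, as (ii) demands.\<close>

lemma count_eq_if_linear_between:
  assumes "satisfies S (u1 @ c # u2) v" "count_list (u1 @ c # u2) z = m + 1"
    and "c \<notin> set u1" "c \<notin> set u2" "c \<noteq> z" "z \<in> set u1" "z \<in> set u2"
  shows "count_list v z = m + 1"
proof -
  define \<sigma> :: "nat \<Rightarrow> word" where "\<sigma> = (\<lambda>y. if y = z then [0] else if y = c then [1] else [])"
  have erase: "subst_word \<sigma> w = replicate (count_list w z) 0" if "c \<notin> set w" for w
    using that by (subst subst_word_erase_others[symmetric], intro subst_word_cong) (auto simp: \<sigma>_def)
  let ?d = "count_list u2 z"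
  have "count_list u1 z \<noteq> 0" "?d \<noteq> 0"
    using assms(6,7) by (simp_all add: count_list_0_iff)
  then have c1: "count_list u1 z = m + 1 - ?d" "0 < ?d" "?d < m + 1"
    using assms(2,5) by auto
  have "satisfies S (replicate (m + 1 - ?d) 0 @ [1] @ replicate ?d 0) (subst_word \<sigma> v)"
    using satisfies_subst[OF assms(1), of \<sigma>] assms(5)
    by (simp add: erase[OF assms(3)] erase[OF assms(4)] c1(1)) (simp add: \<sigma>_def)
  moreover have "subst_word \<sigma> v \<noteq> []"
    using satisfies_set_eq[OF calculation] by (auto simp del: set_subst_word)
  ultimately have "count_list (subst_word \<sigma> v) 0 = m + 1"
    using c1 by (intro linear_gap) auto
  moreover have "count_list (subst_word \<sigma> w) 0 = count_list w z" for w
    by (induction w) (auto simp: \<sigma>_def)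
  ultimately show ?thesis
    by simp
qed

text \<open>Form in which (iii) is used: sortedness is refuted by a single 1 preceding a 0.\<close>

lemma two_powers_sorted:
  assumes "p > 1" "c > 1" "satisfies S (replicate p 0 @ replicate c 1) w"
  shows "sorted w"
proof -
  have "w \<noteq> []"
    using satisfies_set_eq[OF assms(3)] assms(1) by auto
  from two_powers[OF assms(1,2) this assms(3)] show ?thesis
    by (auto simp: sorted_append)
qed

abbreviation lhs :: "nat \<Rightarrow> word" where
  "lhs n \<equiv> replicate m 0 @ squares n @ [0]"

text \<open>Keeping only y_i and y_j, renamed 0 and 1, turns \<open>lhs n\<close> into 0 0 1 1, so
  (iii) excludes a 1 in \<open>P\<close> followed by a 0 in \<open>Q\<close>.\<close>

lemma squares_in_order:
  assumes "satisfies S (lhs n) (P @ Q)" "1 \<le> i" "i < j" "j \<le> n" "j \<in> set P"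
  shows "i \<notin> set Q"
proof
  assume "i \<in> set Q"
  define \<sigma> :: "nat \<Rightarrow> word" where "\<sigma> = (\<lambda>y. if y = i then [0] else if y = j then [1] else [])"
  have [simp]: "subst_word \<sigma> (replicate m 0) = []" "subst_word \<sigma> [0] = []"
    using assms(2,3) by (auto simp: \<sigma>_def subst_word_def)
  have "subst_word \<sigma> (squares n) = [0,0,1,1]"
    using subst_squares_pair[of i j n \<sigma>] assms by (auto simp: \<sigma>_def)
  then have "satisfies S (replicate 2 0 @ replicate 2 1) (subst_word \<sigma> (P @ Q))"
    using satisfies_subst[OF assms(1), of \<sigma>] by (simp add: numeral_2_eq_2 del: subst_word_Cons)
  then have "sorted (subst_word \<sigma> (P @ Q))"
    by (intro two_powers_sorted) auto
  moreover have "1 \<in> set (subst_word \<sigma> P)" "0 \<in> set (subst_word \<sigma> Q)"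
    using assms \<open>i \<in> set Q\<close> by (auto simp: \<sigma>_def intro!: bexI[of _ i] bexI[of _ j])
  ultimately show False
    by (fastforce simp: sorted_append)
qed

text \<open>Otherwise, once the other variables are erased, a power of \<open>a\<close> followed by
  a power of \<open>b\<close> would be identified with the image of \<open>lhs n\<close>, where x
  stands on both sides of y_i. Leaving open which of \<open>a\<close>, \<open>b\<close> is x covers
  both orders at once.\<close>

lemma zero_and_square_not_separated:
  assumes "satisfies S (lhs n) (P @ Q)" "i \<in> {1..n}" "{a, b} = {0, i}" "a \<notin> set Q"
  shows "b \<in> set P"
proof (rule ccontr)
  assume "b \<notin> set P"
  \<comment> \<open>Squaring the variables provides the exponents greater than 1 that (iii) requires.\<close>
  define \<sigma> :: "nat \<Rightarrow> word" where "\<sigma> = (\<lambda>y. if y = a then [0,0] else if y = b then [1,1] else [])"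
  have "a \<noteq> b"
    using assms(2,3) by (auto simp: doubleton_eq_iff)
  have "set (P @ Q) = insert 0 {1..n}"
    using satisfies_set_eq[OF assms(1)] by auto
  then have mem: "a \<in> set P" "b \<in> set Q"
    using assms(2-4) \<open>b \<notin> set P\<close> unfolding set_append doubleton_eq_iff by blast+
  have "\<exists>p. subst_word \<sigma> P = replicate p 0" "\<exists>c. subst_word \<sigma> Q = replicate c 1"
    using \<open>b \<notin> set P\<close> \<open>a \<notin> set Q\<close>
    by (intro subst_word_eq_replicate; auto simp: \<sigma>_def)+
  then obtain p c where p: "subst_word \<sigma> P = replicate p 0" and c: "subst_word \<sigma> Q = replicate c 1"
    by blast
  have "p > 1" "c > 1"
    using length_image_le_subst_word[OF mem(1), of \<sigma>] length_image_le_subst_word[OF mem(2), of \<sigma>]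
      p c \<open>a \<noteq> b\<close> by (auto simp: \<sigma>_def)
  moreover have "satisfies S (replicate p 0 @ replicate c 1) (subst_word \<sigma> (lhs n))"
    using satisfies_sym[OF satisfies_subst[OF assms(1), of \<sigma>]] by (simp add: p c)
  ultimately have "sorted (subst_word \<sigma> (lhs n))"
    by (rule two_powers_sorted)
  moreover have "subst_word \<sigma> (squares n) = \<sigma> i @ \<sigma> i"
    using assms(2,3) by (intro subst_squares_single) (auto simp: \<sigma>_def doubleton_eq_iff)
  ultimately have "sorted (\<sigma> 0 @ \<sigma> i @ \<sigma> i @ \<sigma> 0)"
    using m_pos by (cases m) (auto simp: sorted_append)
  with assms(3) \<open>a \<noteq> b\<close> show False
    by (auto simp: \<sigma>_def doubleton_eq_iff)
qed

section \<open>Invariance of the number of occurrences of x under deduction\<close>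

lemma count_zero_subst_invariant:
  assumes st: "satisfies S s t" and lhs: "satisfies S (lhs n) (subst_word \<sigma> s)"
    and few: "card (set s) < n" and cnt: "count_list (subst_word \<sigma> s) 0 = m + 1"
  shows "count_list (subst_word \<sigma> t) 0 = m + 1"
proof -
  have cnt_sum: "(\<Sum>z\<in>set s. count_list s z * count_list (\<sigma> z) 0) = m + 1"
    using cnt count_subst_word[of "set s" s \<sigma> 0] by simp
  \<comment> \<open>The two counts of 0 are compared summand by summand over the variables of
    \<open>s\<close>.\<close>
  have "count_list t z * count_list (\<sigma> z) 0 = count_list s z * count_list (\<sigma> z) 0"
    if z: "z \<in> set s" for z
  proof (cases "0 \<in> set (\<sigma> z) \<and> count_list s z > m")
    case False
    then show ?thesis
      using count_eq_if_le[OF st, of z] by (auto simp: count_list_0_iff)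
  next
    case True
    have pos: "count_list (\<sigma> z) 0 > 0"
      using True by (auto simp: neq0_conv[symmetric] count_list_0_iff)
    have split: "count_list s z * count_list (\<sigma> z) 0
        + (\<Sum>y\<in>set s - {z}. count_list s y * count_list (\<sigma> y) 0) = m + 1"
      using cnt_sum z by (simp add: sum.remove)
    \<comment> \<open>The summand of \<open>z\<close> already exceeds m, so it exhausts the total m
      + 1 and all other summands vanish.\<close>
    have "count_list s z * 1 \<le> count_list s z * count_list (\<sigma> z) 0"
      using pos by (intro mult_le_mono) auto
    then have cz: "count_list s z = m + 1"
      and "(\<Sum>y\<in>set s - {z}. count_list s y * count_list (\<sigma> y) 0) = 0"
      using True split by linarith+
    then have only_z: "0 \<notin> set (\<sigma> y)" if "y \<in> set s" "y \<noteq> z" for y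
      using that by (auto simp: count_list_0_iff)
    have "\<forall>k\<in>{1..n}. \<exists>c\<in>set s. k \<in> set (\<sigma> c)"
      using satisfies_set_eq[OF lhs] by auto
    then obtain f where f: "\<And>k. k \<in> {1..n} \<Longrightarrow> f k \<in> set s \<and> k \<in> set (\<sigma> (f k))"
      by metis
    have "card (f ` {1..n}) \<le> card (set s)"
      using f by (intro card_mono) auto
    then have "\<not> inj_on f {1..n}"
      using few by (intro pigeonhole) simp
    then obtain i j where ij: "i \<in> {1..n}" "j \<in> {1..n}" "i < j" "f i = f j"
      unfolding inj_on_def by (metis linorder_neqE_nat)
    define c where "c = f j"
    have c: "c \<in> set s" "i \<in> set (\<sigma> c)" "j \<in> set (\<sigma> c)"
      using f[of i] f[of j] ij by (auto simp: c_def)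
    obtain s1 s2 where s: "s = s1 @ c # s2"
      using c(1) by (meson split_list)
    have lhs': "satisfies S (lhs n) (subst_word \<sigma> s1 @ \<sigma> c @ subst_word \<sigma> s2)"
      using lhs by (simp add: s)
    have after: "i \<notin> set (subst_word \<sigma> s2)"
      using squares_in_order[of n "subst_word \<sigma> s1 @ \<sigma> c" "subst_word \<sigma> s2" i j] lhs' ij c by simp
    have before: "j \<notin> set (subst_word \<sigma> s1)"
      using squares_in_order[of n "subst_word \<sigma> s1" "\<sigma> c @ subst_word \<sigma> s2" i j] lhs' ij c by auto
    have "c \<notin> set s1" "c \<notin> set s2"
      using after before c by auto
    \<comment> \<open>\<open>c\<close> occurs once in \<open>s\<close>, while \<open>z\<close>
      occurs m + 1 > 1 times.\<close>
    moreover from this have "c \<noteq> z"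
      using cz m_pos by (auto simp: s)
    \<comment> \<open>No \<open>i\<close> remains after \<open>c\<close>, so some 0 lies in the
      images of \<open>s1\<close> and \<open>c\<close>; only \<open>z\<close> produces 0, hence it
      comes from \<open>s1\<close>. The argument for \<open>s2\<close> is the mirror image, with
      \<open>j\<close> absent before \<open>c\<close>.\<close>
    moreover have "z \<in> set s1"
      using zero_and_square_not_separated[of n "subst_word \<sigma> s1 @ \<sigma> c" "subst_word \<sigma> s2" i i 0]
        lhs' ij after \<open>c \<noteq> z\<close> only_z by (fastforce simp: s)
    moreover have "z \<in> set s2"
      using zero_and_square_not_separated[of n "subst_word \<sigma> s1" "\<sigma> c @ subst_word \<sigma> s2" j 0 j]
        lhs' ij before \<open>c \<noteq> z\<close> only_z by (fastforce simp: s)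
    ultimately show ?thesis
      using count_eq_if_linear_between[of s1 c s2 t z] st cz by (simp add: s)
  qed
  then have "(\<Sum>z\<in>set s. count_list t z * count_list (\<sigma> z) 0) = m + 1"
    unfolding cnt_sum[symmetric] by (rule sum.cong[OF refl])
  then show ?thesis
    using count_subst_word[of "set s" t \<sigma> 0] satisfies_set_eq[OF st] by simp
qed

text \<open>The summand 2 in the bound on \<open>n\<close> makes room for the two variables that
  carry the context \<open>a\<close>, \<open>b\<close> of the step.\<close>

lemma count_zero_deriv_step_invariant:
  assumes \<Sigma>: "\<Sigma> \<subseteq> identities S" "\<And>s t. (s, t) \<in> \<Sigma> \<Longrightarrow> card (set s) + 2 < n"
    and step: "deriv_step \<Sigma> u v" and lhs: "satisfies S (lhs n) u" and cnt: "count_list u 0 = m + 1"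
  shows "satisfies S (lhs n) v \<and> count_list v 0 = m + 1"
proof -
  obtain a b s t \<sigma> where st: "(s, t) \<in> \<Sigma> \<or> (t, s) \<in> \<Sigma>"
    and u: "u = a @ subst_word \<sigma> s @ b" and v: "v = a @ subst_word \<sigma> t @ b"
    using step unfolding deriv_step_def by blast
  have sat: "satisfies S s t"
    using st \<Sigma>(1) satisfies_sym by (auto simp: identities_def)
  note sets = satisfies_set_eq[OF sat]
  have few: "card (set s) + 2 < n"
    using st \<Sigma>(2) sets by metis
  \<comment> \<open>The context of the step is absorbed into the substitution by means of two fresh variables.\<close>
  define p where "p = Suc (Max (set s \<union> {0}))"
  have fresh: "y < p" if "y \<in> set s" for y
    using that by (auto simp: p_def less_Suc_eq_le)
  define \<tau> where "\<tau> = \<sigma>(p := a, Suc p := b)"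
  have \<tau>: "subst_word \<tau> (p # w @ [Suc p]) = a @ subst_word \<sigma> w @ b" if "set w = set s" for w
  proof -
    have "subst_word \<tau> w = subst_word \<sigma> w"
      using that fresh by (intro subst_word_cong) (fastforce simp: \<tau>_def)
    then show ?thesis
      by (simp add: \<tau>_def)
  qed
  have sat': "satisfies S (p # s @ [Suc p]) (p # t @ [Suc p])"
    using satisfies_context[OF sat, of "[p]" "[Suc p]"] by simp
  have "card (set (p # s @ [Suc p])) \<le> card (set s) + 2"
    by (simp add: card_insert_if)
  then have "count_list (subst_word \<tau> (p # t @ [Suc p])) 0 = m + 1"
    using lhs cnt few \<tau>[of s]
    by (intro count_zero_subst_invariant[OF sat', of n \<tau>]) (simp_all add: u del: subst_word_Cons)
  then have "count_list v 0 = m + 1"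
    using \<tau>[of t] sets by (simp add: v del: subst_word_Cons)
  moreover have "satisfies S (lhs n) v"
    using satisfies_trans[OF lhs] satisfies_context[OF satisfies_subst[OF sat]] by (simp add: u v)
  ultimately show ?thesis
    by simp
qed

lemma count_zero_derivable_invariant:
  assumes "\<Sigma> \<subseteq> identities S" "\<And>s t. (s, t) \<in> \<Sigma> \<Longrightarrow> card (set s) + 2 < n"
    and "derivable \<Sigma> (lhs n) v"
  shows "count_list v 0 = m + 1"
proof -
  have "satisfies S (lhs n) v \<and> count_list v 0 = m + 1"
    using assms(3) unfolding derivable_def
  proof (induction rule: rtranclp_induct)
    case base
    show ?case
      by (simp add: satisfies_def count_list_replicate)
  next
    case (step v w)
    then show ?case
      using count_zero_deriv_step_invariant[of \<Sigma> n v w] assms(1,2) by blast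
  qed
  then show ?thesis ..
qed

end

section \<open>Refutation of a finite basis\<close>

theorem theorem7p2:
  fixes S :: "'a::monoid_mult itself" and m :: nat
  assumes m_pos: "m > 0"
    and i: "\<And>n. n > 1 \<Longrightarrow>
      satisfies S (replicate m 0 @ concat (map (\<lambda>k. [k, k]) [1..<n+1]) @ [0])
                  (replicate (m+1) 0 @ concat (map (\<lambda>k. [k, k]) [1..<n+1]) @ [0])"
    and ii: "\<And>d v. 0 < d \<Longrightarrow> d < m + 1 \<Longrightarrow> v \<noteq> [] \<Longrightarrow>
      satisfies S (replicate (m + 1 - d) 0 @ [1] @ replicate d 0) v \<Longrightarrow>
      count_list v 0 = m + 1"
    and iii: "\<And>p c w. p > 1 \<Longrightarrow> c > 1 \<Longrightarrow> w \<noteq> [] \<Longrightarrow>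
      satisfies S (replicate p 0 @ replicate c 1) w \<Longrightarrow>
      (\<exists>i j. i > 1 \<and> j > 1 \<and> w = replicate i 0 @ replicate j 1)"
  shows "\<not> finitely_based S"
proof
  interpret word_conditions S m
    using m_pos ii iii by unfold_locales
  assume "finitely_based S"
  then obtain \<Sigma> where \<Sigma>: "finite \<Sigma>" "\<Sigma> \<subseteq> identities S"
    "\<And>u v. (u, v) \<in> identities S \<Longrightarrow> derivable \<Sigma> u v"
    unfolding finitely_based_def by blast
  \<comment> \<open>The inserted 0 covers an empty \<open>\<Sigma>\<close>; adding 3 makes the bound
    strict and ensures n > 1 for (i). Measuring left sides suffices, as both sides of an identity of
    \<open>S\<close> have the same variables.\<close>
  define n where "n = Max (insert 0 ((\<lambda>(s, t). card (set s)) ` \<Sigma>)) + 3"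
  have n: "card (set s) + 2 < n" if "(s, t) \<in> \<Sigma>" for s t
  proof -
    have "card (set s) \<le> Max (insert 0 ((\<lambda>(s, t). card (set s)) ` \<Sigma>))"
      using that \<Sigma>(1) by (intro Max_ge) force+
    then show ?thesis
      by (simp add: n_def)
  qed
  \<comment> \<open>This is (i); its right side has m + 2 occurrences of 0, against the
    invariant.\<close>
  have "(lhs n, 0 # lhs n) \<in> identities S"
    using i[of n] by (simp add: n_def identities_def squares_def)
  then have "count_list (0 # lhs n) 0 = m + 1"
    using \<Sigma> n by (intro count_zero_derivable_invariant) auto
  then show False
    by (simp add: count_list_replicate)
qed

end
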